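(* Let $m,n$ be integers and $q$ a prime power with $n+q\to\infty$, where $m\ge1$ is constant and $2m<n$. Let $t\to\infty$. Let $\mathcal{F}$ be the family of $m$-flats in $\mathbb{F}_q^n$ (so $|\mathcal{F}|=q^{n-m}\binom{n}{m}_q$, where $\binom{n}{m}_q=\prod_{i=0}^{m-1}\frac{q^n-q^i}{q^m-q^i}$), and let $\ell=q^m$. Let $X$ be the random subset of $\mathbb{F}_q^n$ containing each point independently with probability $\theta$, and let $\Gamma$ be the event that some $m$-flat is entirely contained in $X$. Then: (1) if $\theta<(|\mathcal{F}|t)^{-1/\ell}$, then $\Pr[\Gamma]\to0$; (2) if $\theta>(|\mathcal{F}|t^{-1})^{-1/\ell}$, then $\Pr[\Gamma]\to1$.
   Context: An $m$-flat in $\mathbb{F}_q^n$ is a translate of an $m$-dimensional linear subspace. *)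

theory Defs
  imports
    "HOL-Probability.Probability"
    "HOL-Algebra.AbelCoset"
    "HOL-Number_Theory.Prime_Powers"
    "Jordan_Normal_Form.Missing_VectorSpace"
begin

text \<open>
  The coordinate space $K^n$. Fields are HOL-Algebra structures rather than instances of a
  type class, so that the field, like the dimension, can vary along a sequence.
\<close>

definition coord_space :: "'a ring \<Rightarrow> nat \<Rightarrow> ('a, nat \<Rightarrow> 'a) module" where
  "coord_space K n = LinearCombinations.ring.func_space K {..<n}"

definition flats :: "'a ring \<Rightarrow> nat \<Rightarrow> nat \<Rightarrow> (nat \<Rightarrow> 'a) set set" where
  "flats K n m =
     {a_l_coset (coord_space K n) v W | v W.
        v \<in> carrier (coord_space K n) \<and>
        subspace K W (coord_space K n) \<and>
        vectorspace.dim K ((coord_space K n)\<lparr>carrier := W\<rparr>) = m}"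

definition gauss_binomial :: "nat \<Rightarrow> nat \<Rightarrow> nat \<Rightarrow> real" where
  "gauss_binomial q n m =
     (\<Prod>i<m. (real q ^ n - real q ^ i) / (real q ^ m - real q ^ i))"

text \<open>
  The distribution of the random subset of a finite set \<open>S\<close> that contains each point
  independently with probability \<open>p\<close>. Note that \<^const>\<open>Pi_pmf\<close> requires \<open>S\<close> to be finite
  and that \<^const>\<open>bernoulli_pmf\<close> clamps \<open>p\<close> to the unit interval.
\<close>

definition random_subset :: "'b set \<Rightarrow> real \<Rightarrow> 'b set pmf" where
  "random_subset S p = map_pmf (\<lambda>f. {x \<in> S. f x}) (Pi_pmf S False (\<lambda>_. bernoulli_pmf p))"

text \<open>The probability that the random point set contains an entire \<open>m\<close>-flat.\<close>

definition prob_contains_flat :: "'a ring \<Rightarrow> nat \<Rightarrow> nat \<Rightarrow> real \<Rightarrow> real" where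
  "prob_contains_flat K n m p =
     measure_pmf.prob (random_subset (carrier (coord_space K n)) p)
       {X. \<exists>A \<in> flats K n m. A \<subseteq> X}"

end

theory Submission
  imports Defs
begin

text \<open>
  First and second moment method for the number of \<open>m\<close>-flats contained in \<open>X\<close>.
  The second moment is governed by the pairs of flats \<open>A, B\<close> meeting in a \<open>d\<close>-flat.
  With \<open>S = n - 2 m\<close>, the proportion of flats \<open>B\<close> meeting a given \<open>A\<close> in this way is
  \<open>O(q^{-(d+1) S})\<close>, whereas the correlation gain \<open>\<theta>^{-q^d}\<close> is at most
  \<open>(|F| / t)^{1/q^e}\<close> with \<open>e = m - d\<close> and \<open>|F| = \<Theta>(q^{(m+1)(S+m)})\<close>. The product
  is \<open>O(q^{-S ((d+1) - (m+1)/q^e)} t^{-1/q^e})\<close>. For \<open>d < m\<close> the exponent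
  \<open>(d+1) - (m+1)/q^e\<close> is bounded below by a positive constant, except when \<open>q = 2\<close>,
  \<open>m = 1\<close>, \<open>d = 0\<close>, where it vanishes and the factor \<open>t^{-1/2}\<close> is what tends to 0.
\<close>

section \<open>Counting subspaces and flats over a finite field\<close>

context vectorspace
begin

text \<open>For a subspace \<open>D\<close> this is the span of \<open>D\<close> and
  \<open>x\<close>. The explicit form lets \<open>card_adjoin\<close> count the pairs
  \<open>(d, c)\<close>.\<close>

definition adjoin :: "'c set \<Rightarrow> 'c \<Rightarrow> 'c set" where
  "adjoin D x = {d \<oplus>\<^bsub>V\<^esub> c \<odot>\<^bsub>V\<^esub> x |d c. d \<in> D \<and> c \<in> carrier K}"

lemma subspace_iff:
  "subspace K W V \<longleftrightarrow> W \<subseteq> carrier V \<and> \<zero>\<^bsub>V\<^esub> \<in> W \<and>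
     (\<forall>v\<in>W. \<forall>w\<in>W. v \<oplus>\<^bsub>V\<^esub> w \<in> W) \<and> (\<forall>c\<in>carrier K. \<forall>v\<in>W. c \<odot>\<^bsub>V\<^esub> v \<in> W)"
  using vectorspace_axioms module_axioms
  by (auto simp: subspace_def submodule_def)

lemma subspace_diff:
  assumes "subspace K W V" "v \<in> W" "w \<in> W"
  shows "v \<ominus>\<^bsub>V\<^esub> w \<in> W"
proof -
  have "v \<ominus>\<^bsub>V\<^esub> w = v \<oplus>\<^bsub>V\<^esub> (\<ominus>\<^bsub>K\<^esub> \<one>\<^bsub>K\<^esub>) \<odot>\<^bsub>V\<^esub> w"
    using assms by (subst smult_l_minus) (auto simp: subspace_iff M.minus_eq subset_iff)
  then show ?thesis using assms by (auto simp: subspace_iff)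
qed

lemma subspace_Int:
  assumes "subspace K W V" "subspace K W' V"
  shows "subspace K (W \<inter> W') V"
  using assms by (auto simp: subspace_iff)

lemma adjoin_props:
  assumes D: "subspace K D V" and x: "x \<in> carrier V"
  shows subspace_adjoin: "subspace K (adjoin D x) V"
    and subset_adjoin: "D \<subseteq> adjoin D x"
    and mem_adjoin: "x \<in> adjoin D x"
proof -
  have DV: "d \<in> carrier V" if "d \<in> D" for d using D that by (auto simp: subspace_iff)
  have add: "(d \<oplus>\<^bsub>V\<^esub> c \<odot>\<^bsub>V\<^esub> x) \<oplus>\<^bsub>V\<^esub> (d' \<oplus>\<^bsub>V\<^esub> c' \<odot>\<^bsub>V\<^esub> x) = (d \<oplus>\<^bsub>V\<^esub> d') \<oplus>\<^bsub>V\<^esub> (c \<oplus>\<^bsub>K\<^esub> c') \<odot>\<^bsub>V\<^esub> x"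
    if "d \<in> D" "d' \<in> D" "c \<in> carrier K" "c' \<in> carrier K" for d d' c c'
    using that DV x by (simp add: smult_l_distr M.a_ac)
  have smult: "a \<odot>\<^bsub>V\<^esub> (d \<oplus>\<^bsub>V\<^esub> c \<odot>\<^bsub>V\<^esub> x) = a \<odot>\<^bsub>V\<^esub> d \<oplus>\<^bsub>V\<^esub> (a \<otimes>\<^bsub>K\<^esub> c) \<odot>\<^bsub>V\<^esub> x"
    if "d \<in> D" "a \<in> carrier K" "c \<in> carrier K" for d a c
    using that DV x by (simp add: smult_r_distr smult_assoc1)
  show sub: "D \<subseteq> adjoin D x"
  proof
    fix d assume d: "d \<in> D"
    then have "d = d \<oplus>\<^bsub>V\<^esub> \<zero>\<^bsub>K\<^esub> \<odot>\<^bsub>V\<^esub> x" using DV x by simp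
    with d show "d \<in> adjoin D x" unfolding adjoin_def by blast
  qed
  have "x = \<zero>\<^bsub>V\<^esub> \<oplus>\<^bsub>V\<^esub> \<one>\<^bsub>K\<^esub> \<odot>\<^bsub>V\<^esub> x" using x by simp
  then show "x \<in> adjoin D x"
    using D unfolding adjoin_def by (auto simp: subspace_iff)
  show "subspace K (adjoin D x) V"
    unfolding subspace_iff
  proof (intro conjI ballI)
    show "adjoin D x \<subseteq> carrier V" using DV x by (auto simp: adjoin_def)
    show "\<zero>\<^bsub>V\<^esub> \<in> adjoin D x" using sub D by (auto simp: subspace_iff)
  next
    fix v w assume "v \<in> adjoin D x" "w \<in> adjoin D x"
    then obtain d c d' c' where "v = d \<oplus>\<^bsub>V\<^esub> c \<odot>\<^bsub>V\<^esub> x" "w = d' \<oplus>\<^bsub>V\<^esub> c' \<odot>\<^bsub>V\<^esub> x" 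
      and *: "d \<in> D" "d' \<in> D" "c \<in> carrier K" "c' \<in> carrier K"
      unfolding adjoin_def by blast
    then have "v \<oplus>\<^bsub>V\<^esub> w = (d \<oplus>\<^bsub>V\<^esub> d') \<oplus>\<^bsub>V\<^esub> (c \<oplus>\<^bsub>K\<^esub> c') \<odot>\<^bsub>V\<^esub> x" using add by blast
    moreover have "d \<oplus>\<^bsub>V\<^esub> d' \<in> D" "c \<oplus>\<^bsub>K\<^esub> c' \<in> carrier K" using D * by (auto simp: subspace_iff)
    ultimately show "v \<oplus>\<^bsub>V\<^esub> w \<in> adjoin D x" unfolding adjoin_def by blast
  next
    fix a v assume "v \<in> adjoin D x" and a: "a \<in> carrier K"
    then obtain d c where "v = d \<oplus>\<^bsub>V\<^esub> c \<odot>\<^bsub>V\<^esub> x" and *: "d \<in> D" "c \<in> carrier K"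
      unfolding adjoin_def by blast
    then have "a \<odot>\<^bsub>V\<^esub> v = a \<odot>\<^bsub>V\<^esub> d \<oplus>\<^bsub>V\<^esub> (a \<otimes>\<^bsub>K\<^esub> c) \<odot>\<^bsub>V\<^esub> x" using smult a by blast
    moreover have "a \<odot>\<^bsub>V\<^esub> d \<in> D" "a \<otimes>\<^bsub>K\<^esub> c \<in> carrier K" using D * a by (auto simp: subspace_iff)
    ultimately show "a \<odot>\<^bsub>V\<^esub> v \<in> adjoin D x" unfolding adjoin_def by blast
  qed
qed

lemma adjoin_subset:
  assumes "subspace K W V" "D \<subseteq> W" "x \<in> W"
  shows "adjoin D x \<subseteq> W"
  using assms by (auto simp: adjoin_def subspace_iff)

text \<open>The representation d + c x is unique: if it agrees with d' + c' x, then (c' - c) x = d -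
  d' lies in \<open>D\<close>, and inverting a nonzero c' - c would put \<open>x\<close> itself into
  \<open>D\<close>.\<close>

lemma card_adjoin:
  assumes D: "subspace K D V" and x: "x \<in> carrier V" "x \<notin> D"
  shows "card (adjoin D x) = card D * card (carrier K)"
proof -
  have DV: "d \<in> carrier V" if "d \<in> D" for d using D that by (auto simp: subspace_iff)
  let ?f = "\<lambda>(d, c). d \<oplus>\<^bsub>V\<^esub> c \<odot>\<^bsub>V\<^esub> x"
  have "inj_on ?f (D \<times> carrier K)"
  proof (rule inj_onI, clarify)
    fix d c d' c'
    assume *: "d \<in> D" "c \<in> carrier K" "d' \<in> D" "c' \<in> carrier K"
      and eq: "d \<oplus>\<^bsub>V\<^esub> c \<odot>\<^bsub>V\<^esub> x = d' \<oplus>\<^bsub>V\<^esub> c' \<odot>\<^bsub>V\<^esub> x"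
    have cx: "(c' \<ominus>\<^bsub>K\<^esub> c) \<odot>\<^bsub>V\<^esub> x = c' \<odot>\<^bsub>V\<^esub> x \<oplus>\<^bsub>V\<^esub> \<ominus>\<^bsub>V\<^esub> (c \<odot>\<^bsub>V\<^esub> x)"
      using * x by (simp add: R.minus_eq smult_l_distr smult_l_minus)
    have "d \<ominus>\<^bsub>V\<^esub> d' = (c' \<ominus>\<^bsub>K\<^esub> c) \<odot>\<^bsub>V\<^esub> x"
    proof -
      have "d = (d' \<oplus>\<^bsub>V\<^esub> c' \<odot>\<^bsub>V\<^esub> x) \<oplus>\<^bsub>V\<^esub> \<ominus>\<^bsub>V\<^esub> (c \<odot>\<^bsub>V\<^esub> x)"
        unfolding eq[symmetric] using * DV x by (simp add: M.a_assoc M.r_neg)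
      also have "\<dots> = d' \<oplus>\<^bsub>V\<^esub> (c' \<ominus>\<^bsub>K\<^esub> c) \<odot>\<^bsub>V\<^esub> x"
        unfolding cx using * DV x by (simp add: M.a_assoc)
      finally have "d = d' \<oplus>\<^bsub>V\<^esub> (c' \<ominus>\<^bsub>K\<^esub> c) \<odot>\<^bsub>V\<^esub> x" .
      moreover have "(d' \<oplus>\<^bsub>V\<^esub> (c' \<ominus>\<^bsub>K\<^esub> c) \<odot>\<^bsub>V\<^esub> x) \<ominus>\<^bsub>V\<^esub> d' = (c' \<ominus>\<^bsub>K\<^esub> c) \<odot>\<^bsub>V\<^esub> x"
        using * DV x by (simp add: M.minus_eq M.a_ac M.r_neg1 M.r_neg2)
      ultimately show ?thesis by simp
    qed
    then have mem: "(c' \<ominus>\<^bsub>K\<^esub> c) \<odot>\<^bsub>V\<^esub> x \<in> D" using subspace_diff[OF D *(1,3)] by simp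
    have "c' \<ominus>\<^bsub>K\<^esub> c = \<zero>\<^bsub>K\<^esub>"
    proof (rule ccontr)
      assume nz: "c' \<ominus>\<^bsub>K\<^esub> c \<noteq> \<zero>\<^bsub>K\<^esub>"
      then have u: "c' \<ominus>\<^bsub>K\<^esub> c \<in> Units K" using * field_Units by simp
      have "x = inv\<^bsub>K\<^esub> (c' \<ominus>\<^bsub>K\<^esub> c) \<odot>\<^bsub>V\<^esub> ((c' \<ominus>\<^bsub>K\<^esub> c) \<odot>\<^bsub>V\<^esub> x)"
        using mult_inverse[OF _ x(1) refl nz] * by simp
      then have "x \<in> D" using mem D u R.Units_inv_closed[OF u] by (metis subspace_iff)
      then show False using x by simp
    qed
    then have "c = c'" using * by simp
    moreover have "d = d'" using eq * DV x \<open>c = c'\<close> by simp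
    ultimately show "d = d' \<and> c = c'" by simp
  qed
  moreover have "?f ` (D \<times> carrier K) = adjoin D x" by (auto simp: adjoin_def image_iff)
  ultimately have "card (adjoin D x) = card (D \<times> carrier K)" by (metis card_image)
  then show ?thesis by (simp add: card_cartesian_product)
qed

text \<open>Double counting of the pairs \<open>(x, W)\<close> with \<open>x \<in> W - D\<close>: such a \<open>W\<close> contains
  \<open>adjoin D x\<close>, which reduces \<open>j\<close> by one. The truncated subtractions are harmless:
  \<open>card U = card D * q ^ k\<close> for some \<open>k\<close>, so if \<open>j > k\<close>, the factor \<open>i = k\<close> is 0.\<close>

lemma card_subspaces_between:
  assumes "finite (carrier V)" "subspace K D V" "subspace K U V" "D \<subseteq> U"
  defines "q \<equiv> card (carrier K)"
  shows "card {W. subspace K W V \<and> D \<subseteq> W \<and> W \<subseteq> U \<and> card W = card D * q ^ j}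
           * (\<Prod>i<j. card D * q ^ j - card D * q ^ i)
         = (\<Prod>i<j. card U - card D * q ^ i)"
  using assms(2,4)
proof (induction j arbitrary: D)
  case 0
  have fin: "finite W" if "W \<subseteq> U" for W
    using that assms(1,3) by (meson finite_subset subspace_iff)
  have "W = D" if "D \<subseteq> W" "W \<subseteq> U" "card W = card D" for W
    using card_subset_eq[OF fin[OF that(2)] that(1)] that(3) by simp
  then have "{W. subspace K W V \<and> D \<subseteq> W \<and> W \<subseteq> U \<and> card W = card D * q ^ 0} = {D}"
    using 0 by auto
  then show ?case by simp
next
  case (Suc j)
  have finU: "finite U" using assms(1,3) by (meson finite_subset subspace_iff)
  define G where "G D j = {W. subspace K W V \<and> D \<subseteq> W \<and> W \<subseteq> U \<and> card W = card D * q ^ j}" for D j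
  have finG: "finite (G D j)" for D j
    by (rule finite_subset[of _ "Pow U"]) (use finU in \<open>auto simp: G_def\<close>)
  have UV: "U \<subseteq> carrier V" using assms(3) by (simp add: subspace_iff)
  \<comment> \<open>These are the products of the induction hypothesis for
    \<open>adjoin D x\<close>, because
    \<open>card (adjoin D x) * q ^ i = card D * q ^ Suc i\<close>. The missing factor
    \<open>i = 0\<close> comes from the double count.\<close>
  define P where "P = (\<Prod>i<j. card D * q ^ Suc j - card D * q ^ Suc i)"
  define R where "R = (\<Prod>i<j. card U - card D * q ^ Suc i)"
  have "card (G D (Suc j)) * (card D * q ^ Suc j - card D) = (\<Sum>W\<in>G D (Suc j). card (W - D))"
  proof -
    have "card (W - D) = card D * q ^ Suc j - card D" if "W \<in> G D (Suc j)" for W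
      using that finU by (subst card_Diff_subset) (auto simp: G_def dest: finite_subset)
    then show ?thesis by simp
  qed
  also have "\<dots> = card (SIGMA W:G D (Suc j). W - D)"
    using finG finU by (subst card_SigmaI) (auto simp: G_def dest: finite_subset)
  \<comment> \<open>For \<open>x\<close> outside \<open>D\<close>, a subspace contains
    \<open>D\<close> and \<open>x\<close> exactly if it contains \<open>adjoin D x\<close>, so
    swapping the components exchanges the two ways of counting.\<close>
  also have "\<dots> = card (SIGMA x:U - D. G (adjoin D x) j)"
  proof (rule bij_betw_same_card[of prod.swap], rule bij_betwI[where g = prod.swap])
    show "prod.swap \<in> (SIGMA W:G D (Suc j). W - D) \<rightarrow> (SIGMA x:U - D. G (adjoin D x) j)"
    proof clarsimp
      fix W x assume *: "W \<in> G D (Suc j)" "x \<in> W" "x \<notin> D"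
      then have "x \<in> U" "subspace K W V" "D \<subseteq> W" by (auto simp: G_def)
      moreover have "card (adjoin D x) = card D * q"
        using card_adjoin[OF Suc.prems(1)] * \<open>x \<in> U\<close> UV by (auto simp: q_def)
      ultimately show "x \<in> U \<and> W \<in> G (adjoin D x) j"
        using * adjoin_subset[of W D x] by (simp add: G_def mult_ac)
    qed
    show "prod.swap \<in> (SIGMA x:U - D. G (adjoin D x) j) \<rightarrow> (SIGMA W:G D (Suc j). W - D)"
    proof clarsimp
      fix W x assume *: "W \<in> G (adjoin D x) j" "x \<in> U" "x \<notin> D"
      then have xV: "x \<in> carrier V" using UV by auto
      moreover have "card (adjoin D x) = card D * q"
        using card_adjoin[OF Suc.prems(1) xV] * by (auto simp: q_def)
      ultimately show "W \<in> G D (Suc j) \<and> x \<in> W"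
        using * mem_adjoin[OF Suc.prems(1) xV] subset_adjoin[OF Suc.prems(1) xV]
        by (auto simp: G_def mult_ac)
    qed
  qed auto
  also have "\<dots> = (\<Sum>x\<in>U - D. card (G (adjoin D x) j))"
    using finG finU by (subst card_SigmaI) auto
  finally have count: "card (G D (Suc j)) * (card D * q ^ Suc j - card D)
    = (\<Sum>x\<in>U - D. card (G (adjoin D x) j))" .
  have step: "card (G (adjoin D x) j) * P = R" if x: "x \<in> U - D" for x
  proof -
    have xV: "x \<in> carrier V" using x UV by auto
    have c: "card (adjoin D x) = card D * q" using card_adjoin[OF Suc.prems(1) xV] x by (simp add: q_def)
    show ?thesis
      using Suc.IH[OF subspace_adjoin[OF Suc.prems(1) xV] adjoin_subset[OF assms(3) Suc.prems(2)]] x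
      by (simp add: G_def P_def R_def c mult_ac)
  qed
  have "card (G D (Suc j)) * (\<Prod>i<Suc j. card D * q ^ Suc j - card D * q ^ i)
     = card (G D (Suc j)) * (card D * q ^ Suc j - card D) * P"
    by (simp add: P_def prod.lessThan_Suc_shift del: prod.lessThan_Suc power_Suc)
  also have "\<dots> = (\<Sum>x\<in>U - D. card (G (adjoin D x) j) * P)"
    unfolding count by (simp add: sum_distrib_right)
  also have "\<dots> = card (U - D) * R" using step by simp
  also have "\<dots> = (\<Prod>i<Suc j. card U - card D * q ^ i)"
    using Suc.prems(2) finU
    by (simp add: R_def card_Diff_subset finite_subset prod.lessThan_Suc_shift del: prod.lessThan_Suc power_Suc)
  finally show ?case by (simp add: G_def)
qed

text \<open>Coordinates with respect to a finite basis \<open>B\<close> are a bijection between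
  \<open>carrier V\<close> and the functions from \<open>B\<close> to
  \<open>carrier K\<close>.\<close>

lemma card_eq_power_dim:
  assumes "finite (carrier V)"
  shows "card (carrier V) = card (carrier K) ^ dim"
proof -
  \<comment> \<open>The whole carrier serves as a finite spanning set.\<close>
  have "fin_dim"
    unfolding fin_dim_def using assms in_own_span[of "carrier V"] span_is_subset2[of "carrier V"]
    by blast
  then obtain B where B: "finite B" "basis B" using finite_basis_exists by blast
  then have BV: "B \<subseteq> carrier V" by (simp add: basis_def)
  have "bij_betw (\<lambda>a. lincomb a B) (B \<rightarrow>\<^sub>E carrier K) (carrier V)"
  proof (rule bij_betw_imageI)
    have *: "\<forall>v. v \<in> carrier V \<longrightarrow> (\<exists>!a. a \<in> B \<rightarrow>\<^sub>E carrier K \<and> lincomb a B = v)"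
      using basis_criterion[OF B(1) BV] B by blast
    have cl: "lincomb a B \<in> carrier V" if "a \<in> B \<rightarrow>\<^sub>E carrier K" for a
      using that BV B by (intro lincomb_closed) (auto simp: PiE_def)
    show "inj_on (\<lambda>a. lincomb a B) (B \<rightarrow>\<^sub>E carrier K)"
      by (rule inj_onI) (use * cl in metis)
    show "(\<lambda>a. lincomb a B) ` (B \<rightarrow>\<^sub>E carrier K) = carrier V"
    proof (intro subset_antisym image_subsetI subsetI)
      fix v assume "v \<in> carrier V"
      then obtain a where "a \<in> B \<rightarrow>\<^sub>E carrier K" "lincomb a B = v" using * by metis
      then show "v \<in> (\<lambda>a. lincomb a B) ` (B \<rightarrow>\<^sub>E carrier K)" by blast
    qed (rule cl)
  qed
  then have "card (carrier V) = card (B \<rightarrow>\<^sub>E carrier K)" by (simp add: bij_betw_same_card)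
  also have "\<dots> = card (carrier K) ^ card B" using B by (simp add: card_PiE)
  finally show ?thesis using dim_basis[OF B] by simp
qed

text \<open>Translates the dimension in \<open>flats\<close> into a cardinality, and shows that
  intersections of subspaces have a power of q elements.\<close>

lemma card_subspace_eq_power_dim:
  assumes "finite (carrier V)" "subspace K W V"
  shows "card W = card (carrier K) ^ vectorspace.dim K (vs W)"
  using vectorspace.card_eq_power_dim[OF subspace_is_vs[OF assms(2)]] assms
  by (metis carrier_vs_is_self finite_subset subspace_iff)

end

section \<open>Size of the Gaussian binomial coefficient\<close>

lemma power_diff_ge_half:
  fixes q :: real
  assumes "q \<ge> 2" "i < m"
  shows "q ^ m / 2 \<le> q ^ m - q ^ i"
proof -
  have "2 * q ^ i \<le> q * q ^ i" using assms by simp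
  also have "\<dots> = q ^ Suc i" by simp
  also have "\<dots> \<le> q ^ m" using assms by (intro power_increasing) auto
  finally show ?thesis by simp
qed

text \<open>Each of the m factors lies between q^(n-m) and 2 q^(n-m): the lower bound after clearing
  the denominator, the upper one because the denominator is at least q^m / 2. As m is constant, 2^m
  is harmless.\<close>

lemma gauss_binomial_bounds:
  assumes "q \<ge> 2" "m \<le> n"
  shows gauss_binomial_ge: "real q ^ (m * (n - m)) \<le> gauss_binomial q n m"
    and gauss_binomial_le: "gauss_binomial q n m \<le> 2 ^ m * real q ^ (m * (n - m))"
proof -
  let ?g = "\<lambda>i. (real q ^ n - real q ^ i) / (real q ^ m - real q ^ i)"
  have *: "real q ^ (n - m) \<le> ?g i \<and> ?g i \<le> 2 * real q ^ (n - m)" if "i < m" for i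
  proof -
    have h: "real q ^ m / 2 \<le> real q ^ m - real q ^ i"
      using power_diff_ge_half[of "real q" i m] assms that by simp
    have pos: "real q ^ m - real q ^ i > 0"
      by (rule less_le_trans[OF _ h]) (use assms in simp)
    have n: "real q ^ n = real q ^ (n - m) * real q ^ m"
      using assms by (simp flip: power_add)
    have "1 * real q ^ i \<le> real q ^ (n - m) * real q ^ i"
      using assms by (intro mult_right_mono) auto
    then have lower: "real q ^ (n - m) * (real q ^ m - real q ^ i) \<le> real q ^ n - real q ^ i"
      unfolding n by (simp add: right_diff_distrib)
    have "real q ^ (n - m) * (real q ^ m / 2) \<le> real q ^ (n - m) * (real q ^ m - real q ^ i)"
      using h by (intro mult_left_mono) auto
    moreover have "real q ^ n - real q ^ i \<le> real q ^ n" by simp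
    ultimately have "real q ^ n - real q ^ i \<le> 2 * real q ^ (n - m) * (real q ^ m - real q ^ i)"
      unfolding n by linarith
    then show ?thesis using pos lower
      by (simp add: divide_le_eq le_divide_eq)
  qed
  have "(\<Prod>i<m. real q ^ (n - m)) \<le> gauss_binomial q n m"
    unfolding gauss_binomial_def using * by (intro prod_mono) auto
  then show "real q ^ (m * (n - m)) \<le> gauss_binomial q n m"
    by (simp add: mult.commute flip: power_mult)
  have "gauss_binomial q n m \<le> (\<Prod>i<m. 2 * real q ^ (n - m))"
    unfolding gauss_binomial_def
    by (intro prod_mono conjI) (use * order_trans[of 0 "real q ^ (n - m)"] in auto)
  then show "gauss_binomial q n m \<le> 2 ^ m * real q ^ (m * (n - m))"
    by (simp add: mult.commute power_mult_distrib flip: power_mult)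
qed

section \<open>Translates of subspaces\<close>

context vectorspace
begin

definition cosets_of_card :: "nat \<Rightarrow> 'c set set" where
  "cosets_of_card r = {v <+\<^bsub>V\<^esub> W |v W. v \<in> carrier V \<and> subspace K W V \<and> card W = r}"

lemma coset_eq_image: "v <+\<^bsub>V\<^esub> W = (\<lambda>w. v \<oplus>\<^bsub>V\<^esub> w) ` W"
  by (auto simp: a_l_coset_defs)

lemma inj_on_translate: "v \<in> carrier V \<Longrightarrow> inj_on (\<lambda>w. v \<oplus>\<^bsub>V\<^esub> w) (carrier V)"
  by (auto simp: inj_on_def)

lemma card_coset:
  assumes "v \<in> carrier V" "W \<subseteq> carrier V"
  shows "card (v <+\<^bsub>V\<^esub> W) = card W"
  unfolding coset_eq_image using assms inj_on_translate
  by (intro card_image) (blast intro: inj_on_subset)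

lemma coset_Int:
  assumes "v \<in> carrier V" "W \<subseteq> carrier V" "W' \<subseteq> carrier V"
  shows "(v <+\<^bsub>V\<^esub> W) \<inter> (v <+\<^bsub>V\<^esub> W') = v <+\<^bsub>V\<^esub> (W \<inter> W')"
  unfolding coset_eq_image
  using inj_on_image_Int[OF inj_on_translate[OF assms(1)] assms(2,3)] by simp

lemma coset_eq_iff:
  assumes "v \<in> carrier V" "W \<subseteq> carrier V" "W' \<subseteq> carrier V"
  shows "v <+\<^bsub>V\<^esub> W = v <+\<^bsub>V\<^esub> W' \<longleftrightarrow> W = W'"
  unfolding coset_eq_image
  using inj_on_image_eq_iff[OF inj_on_translate[OF assms(1)] assms(2,3)] by simp

lemma coset_subset_carrier:
  "v \<in> carrier V \<Longrightarrow> W \<subseteq> carrier V \<Longrightarrow> v <+\<^bsub>V\<^esub> W \<subseteq> carrier V"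
  by (auto simp: coset_eq_image)

lemma mem_coset_self:
  assumes "v \<in> carrier V" "subspace K W V"
  shows "v \<in> v <+\<^bsub>V\<^esub> W"
proof -
  have "v = v \<oplus>\<^bsub>V\<^esub> \<zero>\<^bsub>V\<^esub>" using assms by simp
  moreover have "\<zero>\<^bsub>V\<^esub> \<in> W" using assms by (simp add: subspace_iff)
  ultimately show ?thesis unfolding coset_eq_image by (rule image_eqI)
qed

text \<open>With p = v + u, one has v + w = p + (w - u). Hence any point of a flat can be its base
  point, and two flats through p meet in the translate by p of the intersection of their
  directions.\<close>

lemma coset_rebase:
  assumes v: "v \<in> carrier V" and W: "subspace K W V" and p: "p \<in> v <+\<^bsub>V\<^esub> W"
  shows "v <+\<^bsub>V\<^esub> W = p <+\<^bsub>V\<^esub> W"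
proof -
  have WV: "w \<in> carrier V" if "w \<in> W" for w using W that by (auto simp: subspace_iff)
  obtain u where u: "u \<in> W" "p = v \<oplus>\<^bsub>V\<^esub> u" using p by (auto simp: coset_eq_image)
  show ?thesis
  proof (intro subset_antisym subsetI)
    fix x assume "x \<in> v <+\<^bsub>V\<^esub> W"
    then obtain w where w: "w \<in> W" "x = v \<oplus>\<^bsub>V\<^esub> w" by (auto simp: coset_eq_image)
    have "(v \<oplus>\<^bsub>V\<^esub> u) \<oplus>\<^bsub>V\<^esub> (w \<oplus>\<^bsub>V\<^esub> \<ominus>\<^bsub>V\<^esub> u) = (v \<oplus>\<^bsub>V\<^esub> w) \<oplus>\<^bsub>V\<^esub> (u \<oplus>\<^bsub>V\<^esub> \<ominus>\<^bsub>V\<^esub> u)"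
      using u w v WV by (simp add: M.a_ac)
    then have "x = p \<oplus>\<^bsub>V\<^esub> (w \<ominus>\<^bsub>V\<^esub> u)"
      using u w v WV by (simp add: M.minus_eq M.r_neg)
    then show "x \<in> p <+\<^bsub>V\<^esub> W"
      using subspace_diff[OF W w(1) u(1)] by (auto simp: coset_eq_image)
  next
    fix x assume "x \<in> p <+\<^bsub>V\<^esub> W"
    then obtain w where w: "w \<in> W" "x = p \<oplus>\<^bsub>V\<^esub> w" by (auto simp: coset_eq_image)
    have "x = v \<oplus>\<^bsub>V\<^esub> (u \<oplus>\<^bsub>V\<^esub> w)" using u w v WV by (simp add: M.a_assoc)
    moreover have "u \<oplus>\<^bsub>V\<^esub> w \<in> W" using u w W by (auto simp: subspace_iff)
    ultimately show "x \<in> v <+\<^bsub>V\<^esub> W" by (auto simp: coset_eq_image)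
  qed
qed

lemma cosets_of_card_subset_carrier: "A \<in> cosets_of_card r \<Longrightarrow> A \<subseteq> carrier V"
  using coset_subset_carrier by (auto simp: cosets_of_card_def subspace_iff)

lemma card_of_mem_cosets: "A \<in> cosets_of_card r \<Longrightarrow> card A = r"
  using card_coset by (auto simp: cosets_of_card_def subspace_iff)

lemma mem_cosets_of_cardE:
  assumes "A \<in> cosets_of_card r" "p \<in> A"
  obtains W where "subspace K W V" "W \<subseteq> carrier V" "card W = r" "A = p <+\<^bsub>V\<^esub> W"
proof -
  obtain v W where "v \<in> carrier V" "subspace K W V" "card W = r" "A = v <+\<^bsub>V\<^esub> W"
    using assms by (auto simp: cosets_of_card_def)
  then show thesis using that[of W] coset_rebase[of v W p] assms(2) by (auto simp: subspace_iff)
qed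

lemma finite_of_mem_cosets: "finite (carrier V) \<Longrightarrow> A \<in> cosets_of_card r \<Longrightarrow> finite A"
  by (rule finite_subset[OF cosets_of_card_subset_carrier])

lemma finite_cosets_of_card: "finite (carrier V) \<Longrightarrow> finite (cosets_of_card r)"
  by (rule finite_subset[of _ "Pow (carrier V)"]) (use cosets_of_card_subset_carrier in auto)

text \<open>Double counting of the incidences \<open>(A, p)\<close> with \<open>p \<in> A\<close>:
  each coset has \<open>r\<close> points, and once \<open>p\<close> is taken as base point the coset
  corresponds to its direction \<open>W\<close>.\<close>

lemma card_cosets_of_card:
  assumes "finite (carrier V)"
  shows "card (cosets_of_card r) * r = card (carrier V) * card {W. subspace K W V \<and> card W = r}"
proof -
  let ?S = "{W. subspace K W V \<and> card W = r}"
  have finS: "finite ?S"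
    by (rule finite_subset[of _ "Pow (carrier V)"]) (use assms in \<open>auto simp: subspace_iff\<close>)
  have fin: "finite A" if "A \<in> cosets_of_card r" for A
    using that by (rule finite_of_mem_cosets[OF assms])
  have "card (cosets_of_card r) * r = card (SIGMA A:cosets_of_card r. A)"
    using fin finite_cosets_of_card[OF assms] by (simp add: card_SigmaI card_of_mem_cosets)
  also have "\<dots> = card (carrier V \<times> ?S)"
  proof (rule bij_betw_same_card[symmetric], rule bij_betw_imageI)
    let ?f = "\<lambda>(v, W). (v <+\<^bsub>V\<^esub> W, v)"
    show "inj_on ?f (carrier V \<times> ?S)"
      using coset_eq_iff by (auto simp: inj_on_def subspace_iff)
    show "?f ` (carrier V \<times> ?S) = (SIGMA A:cosets_of_card r. A)"
    proof (intro subset_antisym subsetI)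
      fix z assume "z \<in> ?f ` (carrier V \<times> ?S)"
      then show "z \<in> (SIGMA A:cosets_of_card r. A)"
        using mem_coset_self by (auto simp: cosets_of_card_def)
    next
      fix z assume "z \<in> (SIGMA A:cosets_of_card r. A)"
      then obtain A p where z: "z = (A, p)" "A \<in> cosets_of_card r" "p \<in> A" by auto
      then obtain W where "subspace K W V" "card W = r" "A = p <+\<^bsub>V\<^esub> W"
        by (elim mem_cosets_of_cardE)
      moreover have "p \<in> carrier V" using z cosets_of_card_subset_carrier by blast
      ultimately show "z \<in> ?f ` (carrier V \<times> ?S)" using z by (auto simp: image_iff)
    qed
  qed
  finally show ?thesis by (simp add: card_cartesian_product)
qed

end

section \<open>Flats in a space with q^n points, and the ways in which they meet\<close>

locale finite_vectorspace = vectorspace +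
  fixes q n :: nat
  assumes card_K: "card (carrier K) = q" and card_V: "card (carrier V) = q ^ n"
    and q_ge_2: "q \<ge> 2"
begin

lemma finite_carrier: "finite (carrier V)"
  \<comment> \<open>Infinite sets have \<open>card\<close> 0, so a positive cardinality already
    implies finiteness.\<close>
  using card_V q_ge_2 by (simp add: card_ge_0_finite)

lemma zero_subspace: "subspace K {\<zero>\<^bsub>V\<^esub>} V"
  by (auto simp: subspace_iff)

text \<open>The exact count is a product of j quotients with numerators at most q^k and denominators
  at least q^(d+j) / 2, by \<open>power_diff_ge_half\<close>.\<close>

lemma card_subspaces_between_le:
  assumes "subspace K D V" "card D = q ^ d" "subspace K U V" "card U = q ^ k" "D \<subseteq> U" "d + j \<le> k"
  shows "real (card {W. subspace K W V \<and> D \<subseteq> W \<and> W \<subseteq> U \<and> card W = q ^ (d + j)})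
    \<le> (2 * real q ^ (k - (d + j))) ^ j"
proof -
  let ?c = "card {W. subspace K W V \<and> D \<subseteq> W \<and> W \<subseteq> U \<and> card W = q ^ (d + j)}"
  have "?c * (\<Prod>i<j. q ^ (d + j) - q ^ (d + i)) = (\<Prod>i<j. q ^ k - q ^ (d + i))"
    using card_subspaces_between[OF finite_carrier assms(1,3,5), of j] assms(2,4)
    by (simp add: card_K power_add)
  then have "real ?c * real (\<Prod>i<j. q ^ (d + j) - q ^ (d + i)) = real (\<Prod>i<j. q ^ k - q ^ (d + i))"
    by (simp only: of_nat_mult[symmetric])
  \<comment> \<open>The bound on \<open>a\<close> makes the truncated subtraction exact, so the
    identity can be moved to the reals.\<close>
  moreover have "real (q ^ a - q ^ (d + i)) = real q ^ a - real q ^ (d + i)" if "i < j" "d + j \<le> a" for a i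
    using q_ge_2 that by (simp add: of_nat_diff power_increasing)
  ultimately have eq: "real ?c * (\<Prod>i<j. real q ^ (d + j) - real q ^ (d + i))
      = (\<Prod>i<j. real q ^ k - real q ^ (d + i))"
    using assms(6) by simp
  have "real ?c * (real q ^ (d + j) / 2) ^ j = real ?c * (\<Prod>i<j. real q ^ (d + j) / 2)" by simp
  also have "\<dots> \<le> real ?c * (\<Prod>i<j. real q ^ (d + j) - real q ^ (d + i))"
    using power_diff_ge_half[of "real q"] q_ge_2
    by (intro mult_left_mono prod_mono) auto
  also have "\<dots> \<le> (\<Prod>i<j. real q ^ k)"
    unfolding eq
  proof (rule prod_mono)
    fix i assume "i \<in> {..<j}"
    then have "real q ^ (d + i) \<le> real q ^ k"
      using q_ge_2 assms(6) by (intro power_increasing) auto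
    then show "0 \<le> real q ^ k - real q ^ (d + i) \<and> real q ^ k - real q ^ (d + i) \<le> real q ^ k"
      by simp
  qed
  also have "\<dots> = (2 * real q ^ (k - (d + j))) ^ j * (real q ^ (d + j) / 2) ^ j"
  proof -
    have "real q ^ k = 2 * real q ^ (k - (d + j)) * (real q ^ (d + j) / 2)"
      using power_add[of "real q" "k - (d + j)" "d + j"] assms(6) by simp
    then show ?thesis unfolding power_mult_distrib[symmetric] by simp
  qed
  finally show ?thesis
    by (rule mult_right_le_imp_le) (use q_ge_2 in simp)
qed

text \<open>The subspaces between {0} and the whole space give the Gaussian binomial; passing to
  cosets multiplies it by q^n / q^m.\<close>

lemma card_cosets_eq:
  assumes "m \<le> n"
  shows "real (card (cosets_of_card (q ^ m))) = real q ^ (n - m) * gauss_binomial q n m"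
proof -
  let ?c = "card {W. subspace K W V \<and> card W = q ^ m}"
  have VV: "subspace K (carrier V) V" by (auto simp: subspace_iff)
  have "{W. subspace K W V \<and> {\<zero>\<^bsub>V\<^esub>} \<subseteq> W \<and> W \<subseteq> carrier V \<and> card W = q ^ m}
      = {W. subspace K W V \<and> card W = q ^ m}" by (auto simp: subspace_iff)
  then have "?c * (\<Prod>i<m. q ^ m - q ^ i) = (\<Prod>i<m. q ^ n - q ^ i)"
    using card_subspaces_between[OF finite_carrier zero_subspace VV, of m]
    by (simp add: card_K card_V)
  then have "real ?c * real (\<Prod>i<m. q ^ m - q ^ i) = real (\<Prod>i<m. q ^ n - q ^ i)"
    by (simp only: of_nat_mult[symmetric])
  moreover have "real (q ^ a - q ^ i) = real q ^ a - real q ^ i" if "i < m" "m \<le> a" for a i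
    using q_ge_2 that by (simp add: of_nat_diff power_increasing)
  ultimately have eq: "real ?c * (\<Prod>i<m. real q ^ m - real q ^ i) = (\<Prod>i<m. real q ^ n - real q ^ i)"
    using assms by simp
  have "real q ^ m - real q ^ i \<noteq> 0" if "i < m" for i
    using q_ge_2 that by simp
  then have c: "real ?c = gauss_binomial q n m"
    using eq by (simp add: gauss_binomial_def prod_dividef field_simps)
  have "real (card (cosets_of_card (q ^ m))) * real q ^ m = real q ^ n * gauss_binomial q n m"
    using arg_cong[OF card_cosets_of_card[OF finite_carrier, of "q ^ m"], of real]
    by (simp add: card_V c)
  also have "real q ^ n = real q ^ (n - m) * real q ^ m"
    using assms by (simp flip: power_add)
  finally show ?thesis using q_ge_2 by simp
qed

text \<open>From a common base point, the intersection is a translate of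
  \<open>W \<inter> W'\<close>, a subspace of \<open>W\<close>.\<close>

lemma card_Int_cosets:
  assumes "A \<in> cosets_of_card (q ^ m)" "B \<in> cosets_of_card (q ^ m)" "A \<inter> B \<noteq> {}"
  shows "\<exists>d\<le>m. card (A \<inter> B) = q ^ d"
proof -
  obtain p where p: "p \<in> A" "p \<in> B" using assms by auto
  have pV: "p \<in> carrier V" using p cosets_of_card_subset_carrier assms by blast
  obtain W where W: "subspace K W V" "W \<subseteq> carrier V" "card W = q ^ m" "A = p <+\<^bsub>V\<^esub> W"
    using assms(1) p(1) by (rule mem_cosets_of_cardE)
  obtain W' where W': "subspace K W' V" "W' \<subseteq> carrier V" "card W' = q ^ m" "B = p <+\<^bsub>V\<^esub> W'"
    using assms(2) p(2) by (rule mem_cosets_of_cardE)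
  have "card (A \<inter> B) = card (W \<inter> W')"
    using coset_Int[OF pV W(2) W'(2)] card_coset[OF pV, of "W \<inter> W'"] W(2,4) W'(4)
    by (simp add: le_infI1)
  moreover obtain d where "card (W \<inter> W') = q ^ d"
    using card_subspace_eq_power_dim[OF finite_carrier subspace_Int[OF W(1) W'(1)]] card_K by blast
  moreover have "card (W \<inter> W') \<le> q ^ m"
    using card_mono[OF finite_subset[OF W(2) finite_carrier], of "W \<inter> W'"] W(3) by simp
  ultimately show ?thesis using q_ge_2 by (auto simp: power_le_imp_le_exp)
qed

text \<open>Choose a point p of \<open>A \<inter> B\<close> in q^m ways, then the direction D of the
  intersection inside the direction of \<open>A\<close>, then the direction of \<open>B\<close>
  above D. The last two factors come from \<open>card_subspaces_between_le\<close>. A flat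
  \<open>B\<close> is counted once for each p, which an upper bound tolerates.\<close>

lemma card_cosets_meeting_le:
  assumes A: "A \<in> cosets_of_card (q ^ m)" and d: "d \<le> m" "m \<le> n"
  shows "real (card {B \<in> cosets_of_card (q ^ m). A \<inter> B \<noteq> {} \<and> card (A \<inter> B) = q ^ d})
    \<le> real q ^ m * (2 * real q ^ (m - d)) ^ d * (2 * real q ^ (n - m)) ^ (m - d)"
proof -
  let ?B = "\<lambda>p. {B \<in> cosets_of_card (q ^ m). p \<in> B \<and> card (A \<inter> B) = q ^ d}"
  have finA: "finite A" "card A = q ^ m"
    using A by (auto simp: finite_of_mem_cosets[OF finite_carrier] card_of_mem_cosets)
  have finB: "finite (?B p)" for p using finite_cosets_of_card[OF finite_carrier] by simp
  have finS: "finite {W. subspace K W V \<and> P W}" for P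
    by (rule finite_subset[of _ "Pow (carrier V)"]) (use finite_carrier in \<open>auto simp: subspace_iff\<close>)
  have B: "real (card (?B p)) \<le> (2 * real q ^ (m - d)) ^ d * (2 * real q ^ (n - m)) ^ (m - d)"
    if p: "p \<in> A" for p
  proof -
    have pV: "p \<in> carrier V" using p A cosets_of_card_subset_carrier by blast
    obtain U where U: "subspace K U V" "U \<subseteq> carrier V" "card U = q ^ m" "A = p <+\<^bsub>V\<^esub> U"
      using A p by (rule mem_cosets_of_cardE)
    define \<D> where "\<D> = {D. subspace K D V \<and> D \<subseteq> U \<and> card D = q ^ d}"
    define \<W> where "\<W> D = {W. subspace K W V \<and> D \<subseteq> W \<and> card W = q ^ m}" for D
    have fin: "finite \<D>" "finite (\<W> D)" for D unfolding \<D>_def \<W>_def by (rule finS)+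
    \<comment> \<open>The direction W of B is listed under \<open>D = U \<inter> W\<close>. The
      members of \<open>\<W> D\<close> may meet U in more than D, so this is only an
      inclusion.\<close>
    have "?B p \<subseteq> (\<lambda>W. p <+\<^bsub>V\<^esub> W) ` (\<Union>D\<in>\<D>. \<W> D)"
    proof clarify
      fix B assume "B \<in> cosets_of_card (q ^ m)" "p \<in> B" and c: "card (A \<inter> B) = q ^ d"
      then obtain W where W: "subspace K W V" "W \<subseteq> carrier V" "card W = q ^ m" "B = p <+\<^bsub>V\<^esub> W"
        by (elim mem_cosets_of_cardE)
      have "card (U \<inter> W) = q ^ d"
        using c coset_Int[OF pV U(2) W(2)] card_coset[OF pV, of "U \<inter> W"] U(2,4) W(4)
        by (simp add: le_infI1)
      then have "U \<inter> W \<in> \<D>" "W \<in> \<W> (U \<inter> W)"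
        using U W subspace_Int by (auto simp: \<D>_def \<W>_def)
      then show "B \<in> (\<lambda>W. p <+\<^bsub>V\<^esub> W) ` (\<Union>D\<in>\<D>. \<W> D)" using W by blast
    qed
    then have "card (?B p) \<le> card ((\<lambda>W. p <+\<^bsub>V\<^esub> W) ` (\<Union>D\<in>\<D>. \<W> D))"
      using fin by (intro card_mono) auto
    also have "\<dots> \<le> card (\<Union>D\<in>\<D>. \<W> D)" using fin by (intro card_image_le) auto
    also have "\<dots> \<le> (\<Sum>D\<in>\<D>. card (\<W> D))" using fin by (intro card_UN_le)
    finally have "real (card (?B p)) \<le> (\<Sum>D\<in>\<D>. real (card (\<W> D)))" by (simp only: of_nat_sum[symmetric] of_nat_le_iff)
    also have "\<dots> \<le> (\<Sum>D\<in>\<D>. (2 * real q ^ (n - m)) ^ (m - d))"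
    proof (rule sum_mono)
      fix D assume "D \<in> \<D>"
      then have D: "subspace K D V" "card D = q ^ d" "D \<subseteq> carrier V" by (auto simp: \<D>_def subspace_iff)
      have VV: "subspace K (carrier V) V" by (auto simp: subspace_iff)
      have "\<W> D = {W. subspace K W V \<and> D \<subseteq> W \<and> W \<subseteq> carrier V \<and> card W = q ^ (d + (m - d))}"
        using d by (auto simp: \<W>_def subspace_iff)
      then show "real (card (\<W> D)) \<le> (2 * real q ^ (n - m)) ^ (m - d)"
        using card_subspaces_between_le[OF D(1,2) VV card_V D(3), of "m - d"] d by simp
    qed
    also have "\<dots> = real (card \<D>) * (2 * real q ^ (n - m)) ^ (m - d)" by simp
    also have "\<dots> \<le> (2 * real q ^ (m - d)) ^ d * (2 * real q ^ (n - m)) ^ (m - d)"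
    proof (rule mult_right_mono)
      have "\<D> = {W. subspace K W V \<and> {\<zero>\<^bsub>V\<^esub>} \<subseteq> W \<and> W \<subseteq> U \<and> card W = q ^ (0 + d)}"
        by (auto simp: \<D>_def subspace_iff)
      moreover have "{\<zero>\<^bsub>V\<^esub>} \<subseteq> U" using U by (auto simp: subspace_iff)
      ultimately show "real (card \<D>) \<le> (2 * real q ^ (m - d)) ^ d"
        using card_subspaces_between_le[OF zero_subspace _ U(1,3), of 0 d] d by simp
    qed simp
    finally show ?thesis .
  qed
  have "{B \<in> cosets_of_card (q ^ m). A \<inter> B \<noteq> {} \<and> card (A \<inter> B) = q ^ d} \<subseteq> (\<Union>p\<in>A. ?B p)"
    by auto
  then have "card {B \<in> cosets_of_card (q ^ m). A \<inter> B \<noteq> {} \<and> card (A \<inter> B) = q ^ d} \<le> card (\<Union>p\<in>A. ?B p)"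
    using finA finB by (intro card_mono) auto
  also have "\<dots> \<le> (\<Sum>p\<in>A. card (?B p))" using finA by (intro card_UN_le)
  finally have "real (card {B \<in> cosets_of_card (q ^ m). A \<inter> B \<noteq> {} \<and> card (A \<inter> B) = q ^ d})
      \<le> (\<Sum>p\<in>A. real (card (?B p)))" by (simp only: of_nat_sum[symmetric] of_nat_le_iff)
  also have "\<dots> \<le> (\<Sum>p\<in>A. (2 * real q ^ (m - d)) ^ d * (2 * real q ^ (n - m)) ^ (m - d))"
    by (intro sum_mono B)
  also have "\<dots> = real q ^ m * (2 * real q ^ (m - d)) ^ d * (2 * real q ^ (n - m)) ^ (m - d)"
    using finA by simp
  finally show ?thesis .
qed

text \<open>Only \<open>A\<close> itself qualifies. The general bound at d = m would give (2 q)^m,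
  which is unbounded when q grows.\<close>

lemma card_cosets_meeting_full_le:
  assumes A: "A \<in> cosets_of_card (q ^ m)"
  shows "card {B \<in> cosets_of_card (q ^ m). A \<inter> B \<noteq> {} \<and> card (A \<inter> B) = q ^ m} \<le> 1"
proof -
  have "A = B" if "B \<in> cosets_of_card (q ^ m)" "card (A \<inter> B) = q ^ m" for B
  proof -
    have fin: "finite X" if "X \<in> cosets_of_card (q ^ m)" for X
      using that by (rule finite_of_mem_cosets[OF finite_carrier])
    have "A \<inter> B = A" "A \<inter> B = B"
      using that A card_of_mem_cosets fin
      by (intro card_subset_eq; simp)+
    then show ?thesis by simp
  qed
  then have "{B \<in> cosets_of_card (q ^ m). A \<inter> B \<noteq> {} \<and> card (A \<inter> B) = q ^ m} \<subseteq> {A}" by auto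
  from card_mono[OF _ this] show ?thesis by simp
qed

text \<open>For fixed \<open>A\<close> the flats \<open>B\<close> are sorted by the exponent d of
  the intersection; the term d = m is the pair (A, A).\<close>

lemma sum_meeting_cosets_le:
  fixes p :: real
  assumes "m \<le> n" "p > 0"
  defines "F \<equiv> cosets_of_card (q ^ m)"
  shows "(\<Sum>A\<in>F. \<Sum>B\<in>{B\<in>F. A \<inter> B \<noteq> {}}. 1 / p ^ card (A \<inter> B)) \<le>
    real (card F) * (1 / p ^ (q ^ m) + (\<Sum>d<m. real q ^ m * (2 * real q ^ (m - d)) ^ d *
       (2 * real q ^ (n - m)) ^ (m - d) / p ^ (q ^ d)))"
proof -
  have finF: "finite F" unfolding F_def by (rule finite_cosets_of_card[OF finite_carrier])
  have "(\<Sum>B\<in>{B\<in>F. A \<inter> B \<noteq> {}}. 1 / p ^ card (A \<inter> B)) \<le>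
     1 / p ^ (q ^ m) + (\<Sum>d<m. real q ^ m * (2 * real q ^ (m - d)) ^ d *
       (2 * real q ^ (n - m)) ^ (m - d) / p ^ (q ^ d))" if A: "A \<in> F" for A
  proof -
    let ?X = "\<lambda>d. {B\<in>F. A \<inter> B \<noteq> {} \<and> card (A \<inter> B) = q ^ d}"
    have "{B\<in>F. A \<inter> B \<noteq> {}} = (\<Union>d\<in>{..m}. ?X d)"
      using card_Int_cosets[of A m] A by (fastforce simp: F_def)
    moreover have "?X d \<inter> ?X d' = {}" if "d \<noteq> d'" for d d'
      using that q_ge_2 by (auto simp: power_inject_exp)
    ultimately have "(\<Sum>B\<in>{B\<in>F. A \<inter> B \<noteq> {}}. 1 / p ^ card (A \<inter> B))
        = (\<Sum>d\<in>{..m}. \<Sum>B\<in>?X d. 1 / p ^ card (A \<inter> B))"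
      using finF by (simp only:) (intro sum.UNION_disjoint, auto)
    also have "\<dots> = (\<Sum>d\<le>m. real (card (?X d)) / p ^ (q ^ d))"
      by (intro sum.cong refl) simp
    also have "\<dots> = real (card (?X m)) / p ^ (q ^ m) + (\<Sum>d<m. real (card (?X d)) / p ^ (q ^ d))"
      by (simp add: lessThan_Suc_atMost[symmetric])
    also have "\<dots> \<le> 1 / p ^ (q ^ m) + (\<Sum>d<m. real q ^ m * (2 * real q ^ (m - d)) ^ d *
       (2 * real q ^ (n - m)) ^ (m - d) / p ^ (q ^ d))"
      using card_cosets_meeting_full_le[of A m] card_cosets_meeting_le[of A m] assms A
      by (intro add_mono sum_mono divide_right_mono) (auto simp: F_def)
    finally show ?thesis .
  qed
  then show ?thesis by (rule sum_bounded_above)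
qed

end

section \<open>Moments of the number of contained sets\<close>

lemma set_pmf_random_subset:
  assumes "finite S"
  shows "set_pmf (random_subset S p) \<subseteq> Pow S"
  by (auto simp: random_subset_def)

text \<open>The event constrains only the coordinates in \<open>A\<close>, so it is a box whose
  measure is a product of marginals.\<close>

lemma prob_superset_random_subset:
  assumes "finite S" "A \<subseteq> S" "0 \<le> p" "p \<le> 1"
  shows "measure_pmf.prob (random_subset S p) {X. A \<subseteq> X} = p ^ card A"
proof -
  have finA: "finite A" using assms finite_subset by blast
  have "measure_pmf.prob (random_subset S p) {X. A \<subseteq> X} =
    measure_pmf.prob (Pi_pmf S False (\<lambda>_. bernoulli_pmf p)) (Pi S (\<lambda>x. if x \<in> A then {True} else UNIV))"
    unfolding random_subset_def measure_map_pmf using assms(2)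
    by (intro arg_cong[of _ _ "measure_pmf.prob _"]) (auto simp: Pi_def split: if_splits)
  also have "\<dots> = (\<Prod>x\<in>S. if x \<in> A then p else 1)"
    using assms by (subst measure_Pi_pmf_Pi) (auto intro!: prod.cong simp: measure_pmf_single)
  also have "\<dots> = p ^ card A"
    using assms by (simp add: prod.If_cases Int_absorb1)
  finally show ?thesis .
qed

text \<open>First moment: a union bound over \<open>F\<close>.\<close>

lemma prob_contains_member_le:
  fixes p :: real
  assumes "finite S" "\<And>A. A \<in> F \<Longrightarrow> A \<subseteq> S \<and> card A = l" "0 \<le> p" "p \<le> 1"
  shows "measure_pmf.prob (random_subset S p) {X. \<exists>A\<in>F. A \<subseteq> X} \<le> real (card F) * p ^ l"
proof -
  have finF: "finite F" using assms(1,2) by (meson PowI finite_Pow_iff finite_subset subsetI)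
  have "{X. \<exists>A\<in>F. A \<subseteq> X} = (\<Union>A\<in>F. {X. A \<subseteq> X})" by auto
  then have "measure_pmf.prob (random_subset S p) {X. \<exists>A\<in>F. A \<subseteq> X}
      \<le> (\<Sum>A\<in>F. measure_pmf.prob (random_subset S p) {X. A \<subseteq> X})"
    using finF by (simp add: measure_pmf.finite_measure_subadditive_finite)
  also have "\<dots> = (\<Sum>A\<in>F. p ^ l)"
    using assms by (intro sum.cong refl) (simp add: prob_superset_random_subset)
  finally show ?thesis by simp
qed

text \<open>Chebyshev's inequality for the number Z of members of \<open>F\<close> inside X.
  Disjoint pairs contribute no more than their share of the squared mean, so only meeting pairs
  remain.\<close>

lemma prob_contains_no_member_le:
  assumes S: "finite S" and F: "\<And>A. A \<in> F \<Longrightarrow> A \<subseteq> S \<and> card A = l" "F \<noteq> {}" and p: "0 < p" "p \<le> 1"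
  shows "1 - measure_pmf.prob (random_subset S p) {X. \<exists>A\<in>F. A \<subseteq> X}
    \<le> (\<Sum>A\<in>F. \<Sum>B\<in>{B\<in>F. A \<inter> B \<noteq> {}}. 1 / p ^ card (A \<inter> B)) / real (card F) ^ 2"
proof -
  let ?M = "random_subset S p"
  have finF: "finite F" using S F(1) by (meson PowI finite_Pow_iff finite_subset subsetI)
  then have cF: "card F > 0" using F(2) by (simp add: card_gt_0_iff)
  \<comment> \<open>Every real function is integrable because the distribution has finite
    support.\<close>
  have int: "integrable (measure_pmf ?M) (f :: _ \<Rightarrow> real)" for f
    by (rule integrable_measure_pmf_finite) (rule finite_subset[OF set_pmf_random_subset[OF S]], use S in simp)
  define \<mu> where "\<mu> = card F * p ^ l"
  have \<mu>: "\<mu> > 0" using cF p by (simp add: \<mu>_def)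
  define Z :: "'a set \<Rightarrow> real" where "Z X = (\<Sum>A\<in>F. indicator {X. A \<subseteq> X} X)" for X
  have Z1: "measure_pmf.expectation ?M Z = \<mu>"
    unfolding Z_def \<mu>_def using F p S int
    by (subst Bochner_Integration.integral_sum) (auto simp: prob_superset_random_subset)
  have pr: "measure_pmf.prob ?M {X. A \<subseteq> X \<and> B \<subseteq> X} = p ^ (2 * l) / p ^ card (A \<inter> B)"
    if "A \<in> F" "B \<in> F" for A B
  proof -
    have fin: "finite A" "finite B" using F(1) that S finite_subset by blast+
    have "card (A \<union> B) + card (A \<inter> B) = 2 * l"
      using card_Un_Int[OF fin] F(1)[OF that(1)] F(1)[OF that(2)] by simp
    then have "p ^ (2 * l) = p ^ card (A \<union> B) * p ^ card (A \<inter> B)"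
      by (metis power_add)
    then show ?thesis using F(1)[OF that(1)] F(1)[OF that(2)] p S
      using prob_superset_random_subset[OF S, of "A \<union> B" p] by (auto simp: field_simps)
  qed
  have "(\<lambda>X. (Z X)\<^sup>2) = (\<lambda>X. \<Sum>A\<in>F. \<Sum>B\<in>F. indicator {X. A \<union> B \<subseteq> X} X)"
    by (auto simp: Z_def power2_eq_square sum_product indicator_def fun_eq_iff intro!: sum.cong)
  then have Z2: "measure_pmf.expectation ?M (\<lambda>X. (Z X)\<^sup>2) = (\<Sum>A\<in>F. \<Sum>B\<in>F. p ^ (2 * l) / p ^ card (A \<inter> B))"
    using int by (simp add: Bochner_Integration.integral_sum pr)
  \<comment> \<open>For disjoint pairs this is an equality; for meeting pairs the extra 1 is given
    away. The ones sum up to exactly \<open>\<mu>\<^sup>2\<close>.\<close>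
  also have "\<dots> \<le> (\<Sum>A\<in>F. \<Sum>B\<in>F. p ^ (2 * l) * (1 + (if A \<inter> B \<noteq> {} then 1 / p ^ card (A \<inter> B) else 0)))"
    using p by (intro sum_mono) (auto simp: field_simps)
  also have "\<dots> = \<mu>\<^sup>2 + p ^ (2 * l) * (\<Sum>A\<in>F. \<Sum>B\<in>{B\<in>F. A \<inter> B \<noteq> {}}. 1 / p ^ card (A \<inter> B))"
    unfolding \<mu>_def using finF
    by (simp add: distrib_left sum.distrib sum_distrib_left sum.inter_filter power_mult_distrib
        power2_eq_square flip: power_mult power_add mult_2)
  finally have Z2: "measure_pmf.expectation ?M (\<lambda>X. (Z X)\<^sup>2) \<le> \<dots>" .
  have "1 - measure_pmf.prob ?M {X. \<exists>A\<in>F. A \<subseteq> X} = measure_pmf.prob ?M (- {X. \<exists>A\<in>F. A \<subseteq> X})"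
    by (subst measure_pmf.prob_compl[symmetric]) (auto simp: Compl_eq_Diff_UNIV)
  also have "\<dots> = measure_pmf.expectation ?M (indicator (- {X. \<exists>A\<in>F. A \<subseteq> X}))" by simp
  \<comment> \<open>Pointwise: without a contained member Z = 0 and the right side is 1; otherwise
    the left side is 0.\<close>
  also have "\<dots> \<le> measure_pmf.expectation ?M (\<lambda>X. (Z X - \<mu>)\<^sup>2 / \<mu>\<^sup>2)"
  proof (rule integral_mono[OF int int])
    fix X
    have "Z X = 0" if "\<not> (\<exists>A\<in>F. A \<subseteq> X)"
      unfolding Z_def using that by (intro sum.neutral) (auto simp: indicator_def)
    then show "indicator (- {X. \<exists>A\<in>F. A \<subseteq> X}) X \<le> (Z X - \<mu>)\<^sup>2 / \<mu>\<^sup>2"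
      using \<mu> by (auto simp: indicator_def)
  qed
  also have "\<dots> = measure_pmf.expectation ?M (\<lambda>X. ((Z X)\<^sup>2 - 2 * \<mu> * Z X + \<mu>\<^sup>2) / \<mu>\<^sup>2)"
    by (simp add: power2_diff algebra_simps)
  also have "\<dots> = (measure_pmf.expectation ?M (\<lambda>X. (Z X)\<^sup>2) - 2 * \<mu> * \<mu> + \<mu>\<^sup>2) / \<mu>\<^sup>2"
    using int by (simp add: Z1)
  also have "\<dots> \<le> p ^ (2 * l) * (\<Sum>A\<in>F. \<Sum>B\<in>{B\<in>F. A \<inter> B \<noteq> {}}. 1 / p ^ card (A \<inter> B)) / \<mu>\<^sup>2"
    using Z2 by (intro divide_right_mono) (auto simp: power2_eq_square)
  also have "\<dots> = (\<Sum>A\<in>F. \<Sum>B\<in>{B\<in>F. A \<inter> B \<noteq> {}}. 1 / p ^ card (A \<inter> B)) / real (card F) ^ 2"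
    using p cF by (simp add: \<mu>_def power_mult_distrib mult.commute[of 2] flip: power_mult)
  finally show ?thesis .
qed

section \<open>The threshold\<close>

text \<open>With m = d + e this makes the exponent of q^S uniformly negative, by an amount depending
  on m alone. For q = 2 it rests on an integer inequality; for larger q the worst case is q =
  3.\<close>

lemma exponent_gap:
  fixes d e q :: nat
  assumes "e \<ge> 1" "q \<ge> 2" "\<not> (q = 2 \<and> d = 0 \<and> e = 1)"
  shows "real (d + e + 1) / real q ^ e - real (d + 1) \<le> - (1 / 3 ^ (d + e))"
proof (cases "q = 2")
  case True
  \<comment> \<open>The excess of 1 over d + e + 1 becomes the gap 1 / 2^e. The inequality fails
    only in the excluded case, where it reads 3 <= 2.\<close>
  have "d + e + 2 \<le> (d + 1) * 2 ^ e"
  proof (cases "d = 0")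
    case d: True
    then have "e \<ge> 2" using assms True by auto
    then have "e + 2 \<le> 2 ^ e" by (induction e rule: dec_induct) auto
    then show ?thesis using d by simp
  next
    case False
    have "e + 1 \<le> 2 ^ e" by (induction e) auto
    then have "(d + 1) * (e + 1) \<le> (d + 1) * 2 ^ e" by (rule mult_le_mono2)
    moreover have "1 * 1 \<le> d * e" using False assms(1) by (intro mult_le_mono) auto
    ultimately show ?thesis unfolding distrib_left distrib_right by linarith
  qed
  then have "real (d + e + 2) \<le> real ((d + 1) * 2 ^ e)" by (simp only: of_nat_le_iff)
  then have "(real (d + e + 1) + 1) / 2 ^ e \<le> real (d + 1)"
    by (simp add: divide_le_eq distrib_right)
  then have "real (d + e + 1) / 2 ^ e - real (d + 1) \<le> - (1 / 2 ^ e)"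
    by (simp add: add_divide_distrib)
  also have "- (1 / 2 ^ e) \<le> - (1 / 3 ^ (d + e) :: real)"
  proof -
    have "(2::real) ^ e \<le> 3 ^ e" by (intro power_mono) auto
    also have "\<dots> \<le> 3 ^ (d + e)" by (intro power_increasing) auto
    finally show ?thesis by (simp add: frac_le)
  qed
  finally show ?thesis using True by simp
next
  case False
  \<comment> \<open>The aim is a gap of 1/3: the number 3 d + 2 below is d + 1 - 1/3 with its
    denominator cleared.\<close>
  have "2 * e + 1 \<le> 3 ^ e" by (induction e) auto
  then have "(3 * d + 2) * (2 * e + 1) \<le> (3 * d + 2) * 3 ^ e" by (rule mult_le_mono2)
  moreover have "3 * (d + e + 1) \<le> (3 * d + 2) * (2 * e + 1)"
    using assms(1) by (simp add: distrib_left distrib_right)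
  ultimately have "real (3 * (d + e + 1)) \<le> real ((3 * d + 2) * 3 ^ e)"
    by (simp only: of_nat_le_iff)
  then have "real (d + e + 1) \<le> (real (d + 1) - 1 / 3) * 3 ^ e"
    by (simp add: algebra_simps)
  then have "real (d + e + 1) / 3 ^ e \<le> real (d + 1) - 1 / 3"
    by (simp only: pos_divide_le_eq zero_less_power zero_less_numeral)
  then have "real (d + e + 1) / 3 ^ e - real (d + 1) \<le> - (1 / 3)"
    by linarith
  moreover have "real (d + e + 1) / real q ^ e \<le> real (d + e + 1) / 3 ^ e"
    using assms False by (intro divide_left_mono power_mono) auto
  moreover have "(3::real) ^ 1 \<le> 3 ^ (d + e)" using assms(1) by (intro power_increasing) auto
  then have "- (1 / 3) \<le> - (1 / 3 ^ (d + e) :: real)" by (simp add: frac_le)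
  ultimately show ?thesis by linarith
qed

text \<open>\<open>A\<close> bounds the correlation gain, \<open>B\<close> the proportion of flats,
  \<open>C\<close> the part of the exponent free of S, and \<open>D\<close> the part proportional to
  S. The right side is a sum because in each case just one of its two terms is needed.\<close>

lemma second_moment_term_le:
  fixes p t f :: real and q m n d :: nat
  assumes q: "q \<ge> 2" and dm: "d < m" and n: "2 * m < n" and p: "0 < p" and t: "1 \<le> t"
    and f: "real q ^ ((m + 1) * (n - m)) \<le> f" "f \<le> 2 ^ m * real q ^ ((m + 1) * (n - m))"
    and pt: "t \<le> f * p ^ (q ^ m)"
  shows "real q ^ m * (2 * real q ^ (m - d)) ^ d * (2 * real q ^ (n - m)) ^ (m - d) / p ^ (q ^ d) / f
    \<le> 4 ^ m * exp (real (m * (m + 1))) *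
        (real (q ^ (n - 2 * m)) powr - (1 / 3 ^ m) + t powr - (1 / 2))"
proof -
  define e where "e = m - d"
  define S where "S = n - 2 * m"
  define \<alpha> where "\<alpha> = 1 / real q ^ e"
  define Q where "Q = real q"
  have e: "e \<ge> 1" "m = d + e" and nS: "n - m = S + m" "n = S + 2 * m"
    using dm n by (auto simp: e_def S_def)
  have Q: "Q \<ge> 2" using q by (simp add: Q_def)
  have f0: "f > 0" by (rule less_le_trans[OF _ f(1)]) (use q in simp)
  have "Q ^ 1 \<le> Q ^ e" using Q e by (intro power_increasing) auto
  then have \<alpha>: "0 < \<alpha>" "\<alpha> \<le> 1 / Q"
    using Q by (auto simp: \<alpha>_def Q_def frac_le)
  have \<alpha>1: "\<alpha> \<le> 1" by (rule order_trans[OF \<alpha>(2)]) (use Q in simp)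
  \<comment> \<open>Since q^m = q^d q^e, raising to the power 1 / q^e turns the hypothesis on
    p^(q^m) into a lower bound for p^(q^d).\<close>
  have "p ^ (q ^ d) = (p ^ (q ^ m)) powr \<alpha>"
    using p q e by (simp add: \<alpha>_def powr_realpow[symmetric] powr_powr power_add)
  moreover have "t / f \<le> p ^ (q ^ m)" using pt f0 by (simp add: divide_le_eq mult.commute)
  ultimately have "(t / f) powr \<alpha> \<le> p ^ (q ^ d)"
    using t f0 \<alpha> by (simp add: powr_mono2)
  then have "1 / p ^ (q ^ d) \<le> 1 / (t / f) powr \<alpha>"
    using t f0 by (intro divide_left_mono) (auto intro!: mult_pos_pos simp: p)
  also have "\<dots> = f powr \<alpha> * t powr - \<alpha>"
    using t f0 by (simp add: powr_divide powr_minus divide_simps)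
  also have "\<dots> \<le> (2 ^ m * Q powr (real (m + 1) * real (S + m) * \<alpha>)) * t powr - \<alpha>"
  proof (rule mult_right_mono)
    have "f powr \<alpha> \<le> (2 ^ m * Q ^ ((m + 1) * (S + m))) powr \<alpha>"
      using f(2) f0 \<alpha> by (intro powr_mono2) (simp_all only: nS(1) Q_def)
    also have "(2 ^ m * Q ^ N) powr \<alpha> = (2 ^ m) powr \<alpha> * Q powr (real N * \<alpha>)" for N
      using Q by (simp add: powr_mult powr_powr powr_realpow[symmetric])
    also have "real ((m + 1) * (S + m)) = real (m + 1) * real (S + m)" by (rule of_nat_mult)
    also have "(2 ^ m) powr \<alpha> \<le> (2 ^ m :: real) powr 1"
      using \<alpha>1 by (intro powr_mono) auto
    finally show "f powr \<alpha> \<le> 2 ^ m * Q powr (real (m + 1) * real (S + m) * \<alpha>)"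
      by (simp add: mult_right_mono)
  qed simp
  finally have A: "1 / p ^ (q ^ d) \<le> 2 ^ m * Q powr (real (m + 1) * real (S + m) * \<alpha>) * t powr - \<alpha>" .
  have "real q ^ m * (2 * real q ^ (m - d)) ^ d * (2 * real q ^ (n - m)) ^ (m - d)
      = 2 ^ m * Q ^ (m + e * d + (S + m) * e)"
  proof -
    have "Q ^ m * (2 * Q ^ e) ^ d * (2 * Q ^ N) ^ e = 2 ^ (d + e) * Q ^ (m + e * d + N * e)" for N
      by (simp add: power_add power_mult_distrib power_mult)
    then show ?thesis by (simp only: nS(1) e_def[symmetric] Q_def e(2)[symmetric])
  qed
  also have "\<dots> \<le> 2 ^ m * (Q ^ ((m + 1) * (S + m)) * Q powr - (real S * real (d + 1)))"
  proof -
    \<comment> \<open>The exponent of the count falls short of that of f by S (d + 1), with d^2 to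
      spare.\<close>
    have "m + e * d + (S + m) * e + S * (d + 1) + d * d = (m + 1) * (S + m)"
      by (simp add: e(2) algebra_simps)
    then have "m + e * d + (S + m) * e + S * (d + 1) \<le> (m + 1) * (S + m)" by linarith
    then have "Q ^ (m + e * d + (S + m) * e + S * (d + 1)) \<le> Q ^ ((m + 1) * (S + m))"
      using Q by (intro power_increasing) auto
    moreover have "Q powr (real S * real (d + 1)) = Q ^ (S * (d + 1))"
      unfolding of_nat_mult[symmetric] using Q by (intro powr_realpow) simp
    then have "Q ^ (S * (d + 1)) * Q powr - (real S * real (d + 1)) = 1"
      using Q unfolding \<open>Q powr _ = _\<close>[symmetric] powr_add[symmetric] by simp
    then have "Q ^ (m + e * d + (S + m) * e)
        = Q ^ (m + e * d + (S + m) * e + S * (d + 1)) * Q powr - (real S * real (d + 1))"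
      by (simp only: power_add[of Q _ "S * (d + 1)"] mult.assoc mult_1_right)
    ultimately show ?thesis by (simp only: mult_left_mono mult_right_mono powr_ge_zero zero_le_power zero_le_numeral)
  qed
  also have "\<dots> \<le> 2 ^ m * (f * Q powr - (real S * real (d + 1)))"
    using f(1) unfolding nS(1) Q_def by (intro mult_left_mono mult_right_mono) auto
  finally have B: "real q ^ m * (2 * real q ^ (m - d)) ^ d * (2 * real q ^ (n - m)) ^ (m - d) / f
      \<le> 2 ^ m * Q powr - (real S * real (d + 1))"
    using f0 by (simp add: divide_le_eq mult_ac)
  \<comment> \<open>The bound must not depend on q: \<alpha> <= 1 / q and ln q <= q - 1 give
    \<alpha> ln q <= 1.\<close>
  have C: "Q powr (real m * real (m + 1) * \<alpha>) \<le> exp (real (m * (m + 1)))"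
  proof -
    have "\<alpha> * ln Q \<le> 1 / Q * Q"
      using \<alpha> Q ln_le_minus_one[of Q] by (intro mult_mono) auto
    then have "\<alpha> * ln Q \<le> 1" using Q by simp
    then have "real (m * (m + 1)) * (\<alpha> * ln Q) \<le> real (m * (m + 1)) * 1"
      by (intro mult_left_mono) auto
    then show ?thesis using Q by (simp add: powr_def algebra_simps)
  qed
  have D: "Q powr (real S * (real (m + 1) * \<alpha> - real (d + 1))) * t powr - \<alpha>
      \<le> real (q ^ S) powr - (1 / 3 ^ m) + t powr - (1 / 2)"
  proof (cases "q = 2 \<and> d = 0 \<and> e = 1")
    case True
    \<comment> \<open>Here m = 1 and \<alpha> = 1/2, so the power of Q is 1 and the power of t is
      exactly the second term.\<close>
    then show ?thesis by (simp add: \<alpha>_def e(2) Q_def)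
  next
    case False
    have "real (m + 1) * \<alpha> - real (d + 1) \<le> - (1 / 3 ^ m)"
      using exponent_gap[OF e(1) q False] by (simp add: \<alpha>_def e(2))
    then have "real S * (real (m + 1) * \<alpha> - real (d + 1)) \<le> real S * - (1 / 3 ^ m)"
      by (intro mult_left_mono) auto
    then have "Q powr (real S * (real (m + 1) * \<alpha> - real (d + 1))) \<le> Q powr (real S * - (1 / 3 ^ m))"
      using Q by (intro powr_mono) auto
    also have "\<dots> = real (q ^ S) powr - (1 / 3 ^ m)"
      using q by (simp add: Q_def powr_powr powr_realpow[symmetric])
    finally have "Q powr (real S * (real (m + 1) * \<alpha> - real (d + 1))) \<le> real (q ^ S) powr - (1 / 3 ^ m)" .
    moreover have "t powr - \<alpha> \<le> t powr 0" using t \<alpha> by (intro powr_mono) auto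
    ultimately have "Q powr (real S * (real (m + 1) * \<alpha> - real (d + 1))) * t powr - \<alpha>
        \<le> real (q ^ S) powr - (1 / 3 ^ m) * 1"
      using t by (intro mult_mono) auto
    then show ?thesis using powr_ge_zero[of t "- (1 / 2)"] by linarith
  qed
  have "real q ^ m * (2 * real q ^ (m - d)) ^ d * (2 * real q ^ (n - m)) ^ (m - d) / p ^ (q ^ d) / f
     = (real q ^ m * (2 * real q ^ (m - d)) ^ d * (2 * real q ^ (n - m)) ^ (m - d) / f) * (1 / p ^ (q ^ d))"
    by simp
  also have "\<dots> \<le> (2 ^ m * Q powr - (real S * real (d + 1))) *
      (2 ^ m * Q powr (real (m + 1) * real (S + m) * \<alpha>) * t powr - \<alpha>)"
    using A B p by (intro mult_mono) auto
  also have "\<dots> = 4 ^ m * (Q powr (real m * real (m + 1) * \<alpha>) *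
      (Q powr (real S * (real (m + 1) * \<alpha> - real (d + 1))) * t powr - \<alpha>))"
  proof -
    have "Q powr - (real S * real (d + 1)) * Q powr (real (m + 1) * real (S + m) * \<alpha>)
      = Q powr (real m * real (m + 1) * \<alpha>) * Q powr (real S * (real (m + 1) * \<alpha> - real (d + 1)))"
      unfolding powr_add[symmetric] by (intro arg_cong[of _ _ "\<lambda>x. Q powr x"]) (simp add: algebra_simps)
    moreover have "(4::real) ^ m = 2 ^ m * 2 ^ m" by (simp flip: power_mult_distrib)
    ultimately show ?thesis by (simp add: mult_ac)
  qed
  also have "\<dots> \<le> 4 ^ m * (exp (real (m * (m + 1))) *
      (real (q ^ S) powr - (1 / 3 ^ m) + t powr - (1 / 2)))"
    using C D by (intro mult_left_mono mult_mono) auto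
  finally show ?thesis by (simp add: S_def mult.assoc)
qed

text \<open>Links \<open>flats\<close> to the counts above: a subspace has q^dim elements, and q >=
  2 lets the cardinality determine the dimension.\<close>

lemma coord_space_flats:
  fixes K :: "'a ring" and n q :: nat
  assumes K: "field K" and q: "card (carrier K) = q" "q \<ge> 2"
  defines "V \<equiv> coord_space K n"
  shows finite_vectorspace_coord_space: "finite_vectorspace K V q n"
    and flats_eq_cosets_of_card: "flats K n m = vectorspace.cosets_of_card K V (q ^ m)"
proof -
  interpret field K by (fact K)
  have "module K V" unfolding V_def coord_space_def by (rule func_space_is_module)
  then interpret vectorspace K V by (simp add: vectorspace_def K)
  have "card (carrier V) = q ^ n"
    using q by (simp add: V_def coord_space_def func_space_def card_PiE)
  then show fv: "finite_vectorspace K V q n"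
    using q by unfold_locales
  then interpret finite_vectorspace K V q n .
  have "vectorspace.dim K (V\<lparr>carrier := W\<rparr>) = m \<longleftrightarrow> card W = q ^ m" if "subspace K W V" for W
    using card_subspace_eq_power_dim[OF finite_carrier that] q by (simp add: power_inject_exp)
  then show "flats K n m = cosets_of_card (q ^ m)"
    unfolding flats_def cosets_of_card_def V_def[symmetric] by blast
qed

lemma prob_contains_flat_le:
  assumes "field K" "card (carrier K) = q" "q \<ge> 2" "0 \<le> p" "p \<le> 1"
  shows "prob_contains_flat K n m p \<le> real (card (flats K n m)) * p ^ (q ^ m)"
proof -
  interpret finite_vectorspace K "coord_space K n" q n
    by (rule finite_vectorspace_coord_space) fact+
  show ?thesis
    unfolding prob_contains_flat_def flats_eq_cosets_of_card[OF assms(1-3)]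
    using assms finite_carrier cosets_of_card_subset_carrier card_of_mem_cosets
    by (intro prob_contains_member_le) auto
qed

lemma card_flats_eq:
  assumes "field K" "card (carrier K) = q" "q \<ge> 2" "m \<le> n"
  shows "real (card (flats K n m)) = real q ^ (n - m) * gauss_binomial q n m"
proof -
  interpret finite_vectorspace K "coord_space K n" q n
    by (rule finite_vectorspace_coord_space) fact+
  show ?thesis
    unfolding flats_eq_cosets_of_card[OF assms(1-3)] using assms by (intro card_cosets_eq)
qed

text \<open>After division by the number of flats, the pairs with A = B contribute at most 1 / t,
  and each of the m values d < m is bounded by \<open>second_moment_term_le\<close>.\<close>

lemma prob_contains_no_flat_le:
  fixes p t :: real
  assumes K: "field K" "card (carrier K) = q" "q \<ge> 2" and p: "0 < p" "p \<le> 1"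
    and mn: "2 * m < n" and t: "1 \<le> t" "t \<le> real (card (flats K n m)) * p ^ (q ^ m)"
  shows "1 - prob_contains_flat K n m p \<le> 1 / t + real m * (4 ^ m * exp (real (m * (m + 1))) *
        (real (q ^ (n - 2 * m)) powr - (1 / 3 ^ m) + t powr - (1 / 2)))"
proof -
  interpret finite_vectorspace K "coord_space K n" q n
    by (rule finite_vectorspace_coord_space) fact+
  let ?F = "flats K n m"
  let ?f = "real (card ?F)"
  let ?T = "\<lambda>d. real q ^ m * (2 * real q ^ (m - d)) ^ d * (2 * real q ^ (n - m)) ^ (m - d) / p ^ (q ^ d)"
  note F_eq = flats_eq_cosets_of_card[OF K, of n m]
  have f: "?f = real q ^ (n - m) * gauss_binomial q n m"
    using K mn by (intro card_flats_eq) auto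
  have split: "real q ^ ((m + 1) * (n - m)) = real q ^ (n - m) * real q ^ (m * (n - m))"
    unfolding power_add[symmetric] by simp
  have lower: "real q ^ ((m + 1) * (n - m)) \<le> ?f"
    using mult_left_mono[OF gauss_binomial_ge[of q m n], of "real q ^ (n - m)"] K mn
    unfolding f split by simp
  have upper: "?f \<le> 2 ^ m * real q ^ ((m + 1) * (n - m))"
    using mult_left_mono[OF gauss_binomial_le[of q m n], of "real q ^ (n - m)"] K mn
    unfolding f split by (simp add: mult_ac)
  have f0: "?f > 0" by (rule less_le_trans[OF _ lower]) (use K in simp)
  have "1 - prob_contains_flat K n m p
      \<le> (\<Sum>A\<in>?F. \<Sum>B\<in>{B\<in>?F. A \<inter> B \<noteq> {}}. 1 / p ^ card (A \<inter> B)) / ?f ^ 2"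
    unfolding prob_contains_flat_def
    using p finite_carrier f0 cosets_of_card_subset_carrier card_of_mem_cosets
    by (intro prob_contains_no_member_le[where l = "q ^ m"]) (auto simp: F_eq)
  also have "\<dots> \<le> ?f * (1 / p ^ (q ^ m) + (\<Sum>d<m. ?T d)) / ?f ^ 2"
    using sum_meeting_cosets_le[of m p] mn p
    by (intro divide_right_mono) (auto simp: F_eq)
  also have "\<dots> = 1 / (?f * p ^ (q ^ m)) + (\<Sum>d<m. ?T d / ?f)"
  proof -
    have "x * (1 / y + s) / x ^ 2 = 1 / (x * y) + s / x" if "x > 0" "y > 0" for x y s :: real
      using that by (simp add: power2_eq_square field_simps)
    note frac = this
    show ?thesis
      unfolding sum_divide_distrib[symmetric] using f0 p by (intro frac) auto
  qed
  also have "1 / (?f * p ^ (q ^ m)) \<le> 1 / t"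
    using t by (intro divide_left_mono) auto
  also have "(\<Sum>d<m. ?T d / ?f) \<le> (\<Sum>d<m. 4 ^ m * exp (real (m * (m + 1))) *
        (real (q ^ (n - 2 * m)) powr - (1 / 3 ^ m) + t powr - (1 / 2)))"
    using K mn p t lower upper by (intro sum_mono second_moment_term_le) auto
  finally show ?thesis by simp
qed

section \<open>Limits along the sequence of spaces\<close>

theorem theorem4p1:
  fixes K :: "nat \<Rightarrow> 'a ring"
    and m :: nat
    and n q :: "nat \<Rightarrow> nat"
    and t \<theta> :: "nat \<Rightarrow> real"
  assumes "m \<ge> 1"
    and "\<And>k. 2 * m < n k"
    and "\<And>k. primepow (q k)"
    and "\<And>k. field (K k)"
    and "\<And>k. card (carrier (K k)) = q k"
    and "filterlim (\<lambda>k. n k + q k) at_top sequentially"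
    and "filterlim t at_top sequentially"
    and "\<And>k. 0 \<le> \<theta> k \<and> \<theta> k \<le> 1"
  shows "(\<forall>k. real (card (flats (K k) (n k) m)) =
              real (q k) ^ (n k - m) * gauss_binomial (q k) (n k) m)
    \<and> ((\<forall>\<^sub>F k in sequentially.
            \<theta> k < (real (card (flats (K k) (n k) m)) * t k) powr (- 1 / real (q k ^ m)))
        \<longrightarrow> (\<lambda>k. prob_contains_flat (K k) (n k) m (\<theta> k)) \<longlonglongrightarrow> 0)
    \<and> ((\<forall>\<^sub>F k in sequentially.
            \<theta> k > (real (card (flats (K k) (n k) m)) * inverse (t k)) powr (- 1 / real (q k ^ m)))
        \<longrightarrow> (\<lambda>k. prob_contains_flat (K k) (n k) m (\<theta> k)) \<longlonglongrightarrow> 1)"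
proof (intro conjI allI impI)
  have q2: "q k \<ge> 2" for k using primepow_gt_Suc_0[OF assms(3)[of k]] by simp
  let ?f = "\<lambda>k. real (card (flats (K k) (n k) m))"
  let ?P = "\<lambda>k. prob_contains_flat (K k) (n k) m (\<theta> k)"
  show card_eq: "?f k = real (q k) ^ (n k - m) * gauss_binomial (q k) (n k) m" for k
    by (intro card_flats_eq assms q2) (use assms(2)[of k] in simp)
  have f_pos: "?f k > 0" for k
  proof -
    have "0 < real (q k) ^ (m * (n k - m))" using q2[of k] by simp
    also have "\<dots> \<le> gauss_binomial (q k) (n k) m"
      using q2 assms(2)[of k] by (intro gauss_binomial_ge) auto
    finally show ?thesis unfolding card_eq using q2[of k] by simp
  qed
  have l_pos: "q k ^ m > 0" for k using q2[of k] by simp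
  have powr_power: "(x powr (- 1 / real l)) ^ l = 1 / x" if "x > 0" "l > 0" for x :: real and l :: nat
  proof -
    have "(x powr (- 1 / real l)) ^ l = x powr (- 1 / real l * real l)"
      using that powr_realpow[of "x powr (- 1 / real l)" l] by (simp only: powr_powr powr_gt_zero)
    also have "- 1 / real l * real l = - 1" using that by simp
    finally show ?thesis using that by (simp add: powr_minus_divide)
  qed
  have t_ge1: "\<forall>\<^sub>F k in sequentially. t k \<ge> 1"
    using assms(7) by (simp add: filterlim_at_top)
  have inv_t: "(\<lambda>k. 1 / t k) \<longlonglongrightarrow> 0"
    using tendsto_divide_0[OF tendsto_const filterlim_at_top_imp_at_infinity[OF assms(7)]] .
  have P01: "0 \<le> ?P k" "?P k \<le> 1" for k by (simp_all add: prob_contains_flat_def)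

  show "?P \<longlonglongrightarrow> 0"
    if "\<forall>\<^sub>F k in sequentially. \<theta> k < (?f k * t k) powr (- 1 / real (q k ^ m))"
  proof (rule tendsto_sandwich[OF _ _ tendsto_const inv_t])
    show "\<forall>\<^sub>F k in sequentially. ?P k \<le> 1 / t k"
      using that t_ge1
    proof eventually_elim
      case (elim k)
      have "?P k \<le> ?f k * \<theta> k ^ (q k ^ m)"
        using assms(8) by (intro prob_contains_flat_le assms q2) auto
      also have "\<theta> k ^ (q k ^ m) \<le> ((?f k * t k) powr (- 1 / real (q k ^ m))) ^ (q k ^ m)"
        using elim assms(8)[of k] by (intro power_mono) auto
      also have "\<dots> = 1 / (?f k * t k)"
        using f_pos[of k] elim(2) by (intro powr_power l_pos) auto
      finally show ?case using f_pos[of k] by simp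
    qed
  qed (use P01 in auto)

  show "?P \<longlonglongrightarrow> 1"
    if "\<forall>\<^sub>F k in sequentially. \<theta> k > (?f k * inverse (t k)) powr (- 1 / real (q k ^ m))"
  proof -
    \<comment> \<open>An explicit error bound whose only quantities varying with k are t and q^(n -
      2m).\<close>
    define h where "h k = 1 / t k + real m * (4 ^ m * exp (real (m * (m + 1))) *
        (real (q k ^ (n k - 2 * m)) powr - (1 / 3 ^ m) + t k powr - (1 / 2)))" for k
    have "filterlim (\<lambda>k. real (q k ^ (n k - 2 * m))) at_top sequentially"
    proof (rule filterlim_compose[OF filterlim_real_sequentially])
      have "filterlim (\<lambda>k. n k + q k - (2 * m + 1)) at_top sequentially"
        unfolding filterlim_at_top
      proof
        fix Z
        have "\<forall>\<^sub>F k in sequentially. Z + (2 * m + 1) \<le> n k + q k"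
          using assms(6) by (simp only: filterlim_at_top)
        then show "\<forall>\<^sub>F k in sequentially. Z \<le> n k + q k - (2 * m + 1)"
          by eventually_elim linarith
      qed
      \<comment> \<open>With n - 2m = s + 1, which is positive, this says q + s <= q^(s+1). Thus n +
        q tending to infinity suffices, whether n or q grows.\<close>
      moreover have "n k + q k - (2 * m + 1) \<le> q k ^ (n k - 2 * m)" for k
      proof -
        obtain s where s: "n k = 2 * m + Suc s" using assms(2)[of k] less_iff_Suc_add by auto
        have "q k + s \<le> q k ^ Suc s"
        proof (induction s)
          case (Suc s)
          have "q k + Suc s \<le> 2 * (q k + s)" using q2[of k] by simp
          also have "\<dots> \<le> q k * q k ^ Suc s" using Suc q2[of k] by (intro mult_le_mono) auto
          finally show ?case by simp
        qed simp
        then show ?thesis using s by simp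
      qed
      ultimately show "filterlim (\<lambda>k. q k ^ (n k - 2 * m)) at_top sequentially"
        by (rule filterlim_at_top_mono[OF _ always_eventually[OF allI]])
    qed
    then have "h \<longlonglongrightarrow> 0 + real m * (4 ^ m * exp (real (m * (m + 1))) * (0 + 0))"
      unfolding h_def
      by (intro tendsto_add tendsto_mult tendsto_const inv_t tendsto_neg_powr assms(7)) auto
    then have lim: "(\<lambda>k. 1 - h k) \<longlonglongrightarrow> 1" by (auto intro!: tendsto_eq_intros)
    show "?P \<longlonglongrightarrow> 1"
    proof (rule tendsto_sandwich[OF _ _ lim tendsto_const])
      show "\<forall>\<^sub>F k in sequentially. 1 - h k \<le> ?P k"
        using that t_ge1
      proof eventually_elim
        case (elim k)
        have pos: "?f k * inverse (t k) > 0" using f_pos[of k] elim(2) by simp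
        \<comment> \<open>The threshold is positive, hence so is \<open>\<theta> k\<close>, as the
          second moment bound requires.\<close>
        have "0 < (?f k * inverse (t k)) powr (- 1 / real (q k ^ m))"
          unfolding powr_gt_zero using pos by linarith
        then have \<theta>: "0 < \<theta> k" using elim(1) by linarith
        have "1 / (?f k * inverse (t k)) = ((?f k * inverse (t k)) powr (- 1 / real (q k ^ m))) ^ (q k ^ m)"
          using pos l_pos by (intro powr_power[symmetric])
        also have "\<dots> \<le> \<theta> k ^ (q k ^ m)" using elim(1) by (intro power_mono) auto
        finally have "t k \<le> ?f k * \<theta> k ^ (q k ^ m)"
          using f_pos[of k] elim(2) by (simp add: field_simps)
        then have "1 - ?P k \<le> h k"
          unfolding h_def using \<theta> assms(8)[of k] elim(2)
          by (intro prob_contains_no_flat_le assms q2) auto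
        then show ?case by simp
      qed
    qed (use P01 in auto)
  qed
qed

end
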